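(* Let $\mathbb{G}_4$ be the set of all canonical forms of games born by day $4$ under the normal play convention. Then $$10^{28.2} < |\mathbb{G}_4| < 4.0\cdot 10^{184}.$$
   Context: Games are short combinatorial games under normal play: a game is a pair $G=\{\mathcal{L}\mid\mathcal{R}\}$ of finite sets of previously constructed games (the left options and the right options), starting from $0=\{\,\mid\,\}$. Order: $G\ge H$ iff no right option $G^R$ of $G$ satisfies $G^R\le H$ and no left option $H^L$ of $H$ satisfies $G\le H^L$; $G=H$ means $G\ge H$ and $G\le H$; $G>H$ means $G\ge H$ and $G\ne H$. A left option $A$ of $G$ is dominated if there is another left option $B$ with $B\ge A$ (for right options, $B\le A$). A left option $A$ of $G$ is reversible if some right option $A^R$ of $A$ satisfies $A^R\le G$ (for a right option $A$: some left option $A^L$ satisfies $A^L\ge G$). A game is in canonical form if neither it nor any of its followers (positions reachable from it) has a dominated or reversible option; every game equals a unique game in canonical form. A game is born by day $n$ if its game tree has height at most $n$, and $\mathbb{G}_n$ denotes the set of all canonical forms born by day $n$. *)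

theory Defs
  imports Complex_Main "HOL-Library.FSet"
begin

text \<open>Short games as forms: HOL equality on this type is identity of forms, not equality of
  values (\<open>G \<ge> H\<close> and \<open>H \<ge> G\<close>).\<close>

datatype game = Game (left_opts: "game fset") (right_opts: "game fset")

definition is_option :: "game \<Rightarrow> game \<Rightarrow> bool" where
  "is_option X G \<longleftrightarrow> X |\<in>| left_opts G \<or> X |\<in>| right_opts G"

text \<open>The height of the game tree, counted in moves, so that \<open>{ | }\<close> has height \<open>0\<close>.\<close>

primrec height :: "game \<Rightarrow> nat" where
  "height (Game L R) =
     Max (insert 0 (Suc ` (fset (height |`| L) \<union> fset (height |`| R))))"

lemma height_left_opt: "X |\<in>| left_opts G \<Longrightarrow> height X < height G"
  by (cases G) (auto intro!: Max_ge simp: less_eq_Suc_le)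

lemma height_right_opt: "X |\<in>| right_opts G \<Longrightarrow> height X < height G"
  by (cases G) (auto intro!: Max_ge simp: less_eq_Suc_le)

function game_ge :: "game \<Rightarrow> game \<Rightarrow> bool" (infix "\<succeq>" 50) where
  "G \<succeq> H \<longleftrightarrow>
     \<not> (\<exists>GR |\<in>| right_opts G. H \<succeq> GR) \<and>
     \<not> (\<exists>HL |\<in>| left_opts H. HL \<succeq> G)"
  by auto
termination
  by (relation "measure (\<lambda>(G, H). height G + height H)")
     (auto simp: height_left_opt height_right_opt)

text \<open>A rewrite rule with left-hand side \<open>G \<succeq> H\<close> would loop.\<close>

declare game_ge.simps [simp del]

abbreviation game_le :: "game \<Rightarrow> game \<Rightarrow> bool" (infix "\<preceq>" 50) where
  "G \<preceq> H \<equiv> H \<succeq> G"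

definition left_dominated :: "game \<Rightarrow> game \<Rightarrow> bool" where
  "left_dominated G A \<longleftrightarrow>
     A |\<in>| left_opts G \<and> (\<exists>B |\<in>| left_opts G. B \<noteq> A \<and> B \<succeq> A)"

definition right_dominated :: "game \<Rightarrow> game \<Rightarrow> bool" where
  "right_dominated G A \<longleftrightarrow>
     A |\<in>| right_opts G \<and> (\<exists>B |\<in>| right_opts G. B \<noteq> A \<and> B \<preceq> A)"

definition left_reversible :: "game \<Rightarrow> game \<Rightarrow> bool" where
  "left_reversible G A \<longleftrightarrow>
     A |\<in>| left_opts G \<and> (\<exists>AR |\<in>| right_opts A. AR \<preceq> G)"

definition right_reversible :: "game \<Rightarrow> game \<Rightarrow> bool" where
  "right_reversible G A \<longleftrightarrow>
     A |\<in>| right_opts G \<and> (\<exists>AL |\<in>| left_opts A. AL \<succeq> G)"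

text \<open>The reflexive closure makes \<open>G\<close> a follower of itself.\<close>

definition follower :: "game \<Rightarrow> game \<Rightarrow> bool" where
  "follower X G \<longleftrightarrow> is_option\<^sup>*\<^sup>* X G"

definition canonical :: "game \<Rightarrow> bool" where
  "canonical G \<longleftrightarrow>
     (\<forall>X. follower X G \<longrightarrow>
        \<not> (\<exists>A. left_dominated X A \<or> right_dominated X A \<or>
               left_reversible X A \<or> right_reversible X A))"

definition canonical_games :: "nat \<Rightarrow> game set" where
  "canonical_games n = {G. canonical G \<and> height G \<le> n}"

end

theory Submission
  imports Defs
begin

text \<open>
  A game \<open>G\<close> born by day \<open>n + 1\<close> is determined up to equality by the pair \<open>(D, E)\<close>, where
  \<open>D = {X. X \<le> G}\<close> and \<open>E = {X. \<not> X \<ge> G}\<close> in the poset \<open>P\<close> of values born by day \<open>n\<close>.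
  The pairs that occur are exactly the \<open>cuts\<close> of \<open>P\<close>: pairs of down-sets such that every element
  of \<open>D\<close> lies below every element outside \<open>E\<close>; the order of games is componentwise inclusion.
  Iterating this from day 0 yields an explicit poset of 1474 values of day 3, whose cuts are
  counted by \<open>card (canonical_games 4)\<close>.

  For the upper bound, choose an element \<open>m\<close> between \<open>D\<close> and the complement of \<open>E\<close> (it exists
  because the poset is a lattice) and decompose the poset greedily into 91 chains: each chain of \<open>k\<close>
  elements contributes at most \<open>(k + 3)\<^sup>2 / 4\<close> choices, about \<open>10\<^bsup>169\<^esup>\<close> cuts in total.
  For the lower bound, take an antichain \<open>A\<close> of 79 elements and an antichain \<open>B\<close> of 20 elements
  such that all of \<open>A\<close> lies below all of \<open>B\<close>; down-sets generated by subsets of \<open>A\<close> and up-sets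
  generated by subsets of \<open>B\<close> give \<open>2\<^bsup>99\<^esup>\<close> cuts.
\<close>

section \<open>The order on games and canonical forms\<close>

lemma geI:
  assumes "\<And>X. X |\<in>| right_opts G \<Longrightarrow> \<not> H \<succeq> X"
    and "\<And>X. X |\<in>| left_opts H \<Longrightarrow> \<not> X \<succeq> G"
  shows "G \<succeq> H"
  using assms by (subst game_ge.simps) blast

lemma ge_right_opt: "G \<succeq> H \<Longrightarrow> X |\<in>| right_opts G \<Longrightarrow> \<not> H \<succeq> X"
  by (subst (asm) game_ge.simps) blast

lemma ge_left_opt: "G \<succeq> H \<Longrightarrow> X |\<in>| left_opts H \<Longrightarrow> \<not> X \<succeq> G"
  by (subst (asm) game_ge.simps) blast

text \<open>A right option \<open>X\<close> with \<open>G \<succeq> X\<close> would give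
  \<open>\<not> X \<succeq> X\<close> by the definition of the order, against the induction
  hypothesis; left options are symmetric.\<close>

lemma ge_refl: "G \<succeq> G"
proof (induction G rule: measure_induct_rule[of height])
  case (less G)
  then show ?case
    by (intro geI) (meson ge_left_opt ge_right_opt height_left_opt height_right_opt)+
qed

text \<open>An option \<open>X\<close> of an outer game rotates the triple to (H, K, X) or (X, G,
  H), which has smaller total height. Hence the induction on the sum of all three heights.\<close>

lemma ge_trans: "G \<succeq> H \<Longrightarrow> H \<succeq> K \<Longrightarrow> G \<succeq> K"
proof (induction "height G + height H + height K" arbitrary: G H K rule: less_induct)
  case less
  show ?case
  proof (rule geI)
    fix X assume X: "X |\<in>| right_opts G"
    show "\<not> K \<succeq> X"
    proof
      assume "K \<succeq> X"
      then have "H \<succeq> X"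
        using less.hyps[of H K X] less.prems height_right_opt[OF X] by simp
      then show False
        using ge_right_opt less.prems(1) X by blast
    qed
  next
    fix X assume X: "X |\<in>| left_opts K"
    show "\<not> X \<succeq> G"
    proof
      assume "X \<succeq> G"
      then have "X \<succeq> H"
        using less.hyps[of X G H] less.prems height_left_opt[OF X] by simp
      then show False
        using ge_left_opt less.prems(2) X by blast
    qed
  qed
qed

lemma not_ge_left_opt: "X |\<in>| left_opts G \<Longrightarrow> \<not> X \<succeq> G"
  using ge_left_opt ge_refl by blast

lemma not_right_opt_le: "X |\<in>| right_opts G \<Longrightarrow> \<not> G \<succeq> X"
  using ge_right_opt ge_refl by blast

lemma height_le_iff: "height G \<le> n \<longleftrightarrow> (\<forall>X. is_option X G \<longrightarrow> height X < n)"
  by (cases G) (auto simp: is_option_def Suc_le_eq)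

text \<open>A form of height at most \<open>Suc n\<close> is a pair of subsets of the finite set of
  forms of height at most \<open>n\<close>. Finiteness later allows such sets to serve as option
  sets of type \<open>fset\<close>.\<close>

lemma finite_height_le: "finite {G. height G \<le> n}"
proof (induction n)
  case 0
  have "{G. height G \<le> 0} \<subseteq> {Game {||} {||}}"
  proof
    fix G assume "G \<in> {G. height G \<le> 0}"
    then have "\<not> is_option X G" for X
      using height_le_iff[of G 0] by simp
    then show "G \<in> {Game {||} {||}}"
      by (cases G) (auto simp: is_option_def)
  qed
  then show ?case
    using finite_subset by blast
next
  case (Suc n)
  let ?S = "{G. height G \<le> n}"
  have "finite (fset -` Pow ?S)"
    using Suc.IH by (intro finite_vimageI) (simp_all add: inj_on_def fset_inject)
  then have fin: "finite {L. fset L \<subseteq> ?S}"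
    by (simp add: vimage_def)
  have "{G. height G \<le> Suc n}
      \<subseteq> (\<lambda>(L, R). Game L R) ` ({L. fset L \<subseteq> ?S} \<times> {R. fset R \<subseteq> ?S})"
  proof
    fix G assume "G \<in> {G. height G \<le> Suc n}"
    then have "is_option X G \<Longrightarrow> height X \<le> n" for X
      using height_le_iff[of G "Suc n"] by auto
    then show "G \<in> (\<lambda>(L, R). Game L R) ` ({L. fset L \<subseteq> ?S} \<times> {R. fset R \<subseteq> ?S})"
      by (intro image_eqI[of _ _ "(left_opts G, right_opts G)"]) (auto simp: is_option_def)
  qed
  then show ?case
    using finite_subset[OF _ finite_imageI[OF finite_cartesian_product[OF fin fin]]] by blast
qed

section \<open>Uniqueness of canonical forms\<close>

definition reduced :: "game \<Rightarrow> bool" where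
  "reduced G \<longleftrightarrow> \<not> (\<exists>A. left_dominated G A \<or> right_dominated G A \<or>
     left_reversible G A \<or> right_reversible G A)"

text \<open>Replaces the quantification over followers by a recursion over options, the shape that
  inductions on height use.\<close>

lemma canonical_iff:
  "canonical G \<longleftrightarrow> reduced G \<and> (\<forall>X. is_option X G \<longrightarrow> canonical X)"
proof
  assume G: "canonical G"
  have "canonical X" if "is_option X G" for X
    unfolding canonical_def follower_def
  proof (intro allI impI)
    fix Y assume "is_option\<^sup>*\<^sup>* Y X"
    then have "follower Y G"
      unfolding follower_def using that by (rule rtranclp.rtrancl_into_rtrancl)
    then show "\<not> (\<exists>A. left_dominated Y A \<or> right_dominated Y A \<or>
        left_reversible Y A \<or> right_reversible Y A)"
      using G unfolding canonical_def by blast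
  qed
  moreover have "reduced G"
    using G unfolding canonical_def reduced_def follower_def by blast
  ultimately show "reduced G \<and> (\<forall>X. is_option X G \<longrightarrow> canonical X)"
    by blast
next
  assume G: "reduced G \<and> (\<forall>X. is_option X G \<longrightarrow> canonical X)"
  show "canonical G"
    unfolding canonical_def
  proof (intro allI impI)
    fix X assume "follower X G"
    then have "X = G \<or> (\<exists>Y. follower X Y \<and> is_option Y G)"
      unfolding follower_def by (auto elim: rtranclp.cases)
    then show "\<not> (\<exists>A. left_dominated X A \<or> right_dominated X A \<or>
        left_reversible X A \<or> right_reversible X A)"
      using G unfolding canonical_def reduced_def by blast
  qed
qed

text \<open>A left option \<open>A\<close> of \<open>G\<close> lies below some left option
  \<open>B\<close> of \<open>H\<close>: \<open>A \<succeq> H\<close> fails, and since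
  \<open>A\<close> is not reversible, no right option of \<open>A\<close> can be the cause. Going
  back from \<open>B\<close> gives \<open>C\<close> in \<open>G\<close> above \<open>A\<close>; as
  \<open>A\<close> is not dominated, \<open>C = A\<close>, so \<open>A\<close> and \<open>B\<close>
  are equal in value. The hypothesis \<open>eq\<close> will be supplied by induction.\<close>

lemma canonical_left_opts_subset:
  assumes G: "reduced G" and H: "reduced H" and "G \<succeq> H" "H \<succeq> G"
    and eq: "\<And>A B. A |\<in>| left_opts G \<Longrightarrow> B |\<in>| left_opts H \<Longrightarrow> A \<succeq> B \<Longrightarrow> B \<succeq> A \<Longrightarrow> A = B"
  shows "left_opts G |\<subseteq>| left_opts H"
proof
  have dominating: "\<exists>B. B |\<in>| left_opts H' \<and> B \<succeq> A"
    if "reduced G'" "G' \<succeq> H'" "H' \<succeq> G'" "A |\<in>| left_opts G'" for G' H' A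
  proof -
    have "\<not> A \<succeq> H'"
      using that ge_trans not_ge_left_opt by blast
    moreover have "\<not> H' \<succeq> X" if "X |\<in>| right_opts A" for X
      using \<open>reduced G'\<close> \<open>A |\<in>| left_opts G'\<close> \<open>G' \<succeq> H'\<close> that ge_trans
      unfolding reduced_def left_reversible_def by blast
    ultimately show ?thesis
      using geI[of A H'] by blast
  qed
  fix A assume A: "A |\<in>| left_opts G"
  obtain B where B: "B |\<in>| left_opts H" "B \<succeq> A"
    using dominating G assms(3,4) A by blast
  obtain C where C: "C |\<in>| left_opts G" "C \<succeq> B"
    using dominating H assms(3,4) B(1) by blast
  have "C = A"
    using G A B C ge_trans unfolding reduced_def left_dominated_def by blast
  then show "A |\<in>| left_opts H"
    using eq A B C by blast
qed

lemma canonical_right_opts_subset: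
  assumes G: "reduced G" and H: "reduced H" and "G \<succeq> H" "H \<succeq> G"
    and eq: "\<And>A B. A |\<in>| right_opts G \<Longrightarrow> B |\<in>| right_opts H \<Longrightarrow> A \<succeq> B \<Longrightarrow> B \<succeq> A \<Longrightarrow> A = B"
  shows "right_opts G |\<subseteq>| right_opts H"
proof
  have dominating: "\<exists>B. B |\<in>| right_opts H' \<and> A \<succeq> B"
    if "reduced G'" "G' \<succeq> H'" "H' \<succeq> G'" "A |\<in>| right_opts G'" for G' H' A
  proof -
    have "\<not> H' \<succeq> A"
      using that ge_trans not_right_opt_le by blast
    moreover have "\<not> X \<succeq> H'" if "X |\<in>| left_opts A" for X
      using \<open>reduced G'\<close> \<open>A |\<in>| right_opts G'\<close> \<open>H' \<succeq> G'\<close> that ge_trans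
      unfolding reduced_def right_reversible_def by blast
    ultimately show ?thesis
      using geI[of H' A] by blast
  qed
  fix A assume A: "A |\<in>| right_opts G"
  obtain B where B: "B |\<in>| right_opts H" "A \<succeq> B"
    using dominating G assms(3,4) A by blast
  obtain C where C: "C |\<in>| right_opts G" "B \<succeq> C"
    using dominating H assms(3,4) B(1) by blast
  have "C = A"
    using G A B C ge_trans unfolding reduced_def right_dominated_def by blast
  then show "A |\<in>| right_opts H"
    using eq A B C by blast
qed

lemma canonical_unique:
  "canonical G \<Longrightarrow> canonical H \<Longrightarrow> G \<succeq> H \<Longrightarrow> H \<succeq> G \<Longrightarrow> G = H"
proof (induction "height G + height H" arbitrary: G H rule: less_induct)
  case less
  have G: "reduced G" and H: "reduced H"
    using less.prems canonical_iff by blast+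
  have left: "A = B"
    if "A |\<in>| left_opts G" "B |\<in>| left_opts H" "A \<succeq> B" "B \<succeq> A" for A B
    using that less.prems canonical_iff[of G] canonical_iff[of H]
      height_left_opt[OF that(1)] height_left_opt[OF that(2)]
    by (intro less.hyps) (auto simp: is_option_def)
  have right: "A = B"
    if "A |\<in>| right_opts G" "B |\<in>| right_opts H" "A \<succeq> B" "B \<succeq> A" for A B
    using that less.prems canonical_iff[of G] canonical_iff[of H]
      height_right_opt[OF that(1)] height_right_opt[OF that(2)]
    by (intro less.hyps) (auto simp: is_option_def)
  have "left_opts G = left_opts H"
    using canonical_left_opts_subset[OF G H less.prems(3,4)]
      canonical_left_opts_subset[OF H G less.prems(4,3)] left
    by (metis (no_types, lifting) fsubset_antisym)
  moreover have "right_opts G = right_opts H"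
    using canonical_right_opts_subset[OF G H less.prems(3,4)]
      canonical_right_opts_subset[OF H G less.prems(4,3)] right
    by (metis (no_types, lifting) fsubset_antisym)
  ultimately show ?case
    by (rule game.expand[OF conjI])
qed

section \<open>Existence of canonical forms\<close>

text \<open>A measure that decreases under both simplifications. Bypassing a reversible option
  \<open>A\<close> may insert many new options, but they are options of an option of
  \<open>A\<close>, and their trees together have fewer nodes than the tree of
  \<open>A\<close>.\<close>

function nodes :: "game \<Rightarrow> nat" where
  "nodes G = Suc ((\<Sum>X\<in>fset (left_opts G). nodes X) + (\<Sum>X\<in>fset (right_opts G). nodes X))"
  by auto
termination
  by (relation "measure height") (auto simp: height_left_opt height_right_opt)

declare nodes.simps [simp del]

lemma sum_replace_less:
  fixes f :: "'a \<Rightarrow> nat"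
  assumes "finite S" "finite M" "a \<in> S" "sum f M < f a"
  shows "sum f (S - {a} \<union> M) < sum f S"
proof -
  have "sum f (S - {a} \<union> M) \<le> sum f (S - {a}) + sum f M"
    using assms sum.union_inter[of "S - {a}" M f] by simp
  also have "\<dots> < sum f (S - {a}) + f a"
    using assms by simp
  also have "\<dots> = sum f S"
    using assms sum.remove[of S a f] by simp
  finally show ?thesis .
qed

lemma nodes_left_less:
  assumes "A |\<in>| left_opts G"
  shows "nodes A < nodes G"
  using assms member_le_sum[of A "fset (left_opts G)" nodes] nodes.simps[of G] by simp

lemma nodes_right_less:
  assumes "A |\<in>| right_opts G"
  shows "nodes A < nodes G"
  using assms member_le_sum[of A "fset (right_opts G)" nodes] nodes.simps[of G] by simp

text \<open>The two games share their right options, and no game is above one of its own right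
  options; so only the left options of the smaller game remain to be checked.\<close>

lemma ge_change_left:
  assumes "\<And>X. X |\<in>| L \<Longrightarrow> \<not> X \<succeq> Game L' R"
  shows "Game L' R \<succeq> Game L R"
  using assms not_right_opt_le[of _ "Game L R"] by (intro geI) auto

lemma ge_change_right:
  assumes "\<And>X. X |\<in>| R \<Longrightarrow> \<not> Game L R' \<succeq> X"
  shows "Game L R \<succeq> Game L R'"
  using assms not_ge_left_opt[of _ "Game L R"] by (intro geI) auto

definition equivalent :: "game \<Rightarrow> game \<Rightarrow> bool" (infix "\<approx>" 50) where
  "G \<approx> H \<longleftrightarrow> G \<succeq> H \<and> H \<succeq> G"

lemma remove_left_dominated:
  assumes "left_dominated (Game L R) A"
  shows "Game L R \<approx> Game (L |-| {|A|}) R"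
  unfolding equivalent_def
proof
  show "Game L R \<succeq> Game (L |-| {|A|}) R"
    using not_ge_left_opt[of _ "Game L R"] by (intro ge_change_left) auto
  obtain B where B: "B |\<in>| L |-| {|A|}" "B \<succeq> A"
    using assms unfolding left_dominated_def by auto
  have "\<not> B \<succeq> Game (L |-| {|A|}) R"
    using B(1) not_ge_left_opt by simp
  then have "\<not> A \<succeq> Game (L |-| {|A|}) R"
    using B(2) ge_trans by blast
  then show "Game (L |-| {|A|}) R \<succeq> Game L R"
    using not_ge_left_opt[of _ "Game (L |-| {|A|}) R"] by (intro ge_change_left) auto
qed

lemma remove_right_dominated:
  assumes "right_dominated (Game L R) A"
  shows "Game L R \<approx> Game L (R |-| {|A|})"
  unfolding equivalent_def
proof
  show "Game L (R |-| {|A|}) \<succeq> Game L R"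
    using not_right_opt_le[of _ "Game L R"] by (intro ge_change_right) auto
  obtain B where B: "B |\<in>| R |-| {|A|}" "A \<succeq> B"
    using assms unfolding right_dominated_def by auto
  have "\<not> Game L (R |-| {|A|}) \<succeq> B"
    using B(1) not_right_opt_le by simp
  then have "\<not> Game L (R |-| {|A|}) \<succeq> A"
    using B(2) ge_trans by blast
  then show "Game L R \<succeq> Game L (R |-| {|A|})"
    using not_right_opt_le[of _ "Game L (R |-| {|A|})"] by (intro ge_change_right) auto
qed

lemma bypass_left_reversible:
  assumes "B |\<in>| right_opts A" "Game L R \<succeq> B"
  shows "Game L R \<approx> Game (L |-| {|A|} |\<union>| left_opts B) R"
    (is "_ \<approx> ?H")
  unfolding equivalent_def
proof
  show "Game L R \<succeq> ?H"
    using assms not_ge_left_opt[of _ "Game L R"] not_ge_left_opt[of _ B] ge_trans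
    by (intro ge_change_left) (auto, blast)
  \<comment> \<open>Left options of \<open>B\<close> are left options of \<open>?H\<close>, and
    right options of \<open>?H\<close> cannot be below \<open>B\<close>, as \<open>B\<close> is
    below the original game. Since \<open>B\<close> is a right option of \<open>A\<close>, this
    rules out \<open>A \<succeq> ?H\<close>.\<close>
  have "?H \<succeq> B"
    using assms(2) not_right_opt_le[of _ "Game L R"] not_ge_left_opt[of _ ?H] ge_trans
    by (intro geI) (auto, blast)
  then have "\<not> A \<succeq> ?H"
    using assms(1) ge_right_opt by blast
  then show "?H \<succeq> Game L R"
    using not_ge_left_opt[of _ ?H] by (intro ge_change_left) auto
qed

lemma bypass_right_reversible:
  assumes "B |\<in>| left_opts A" "B \<succeq> Game L R"
  shows "Game L R \<approx> Game L (R |-| {|A|} |\<union>| right_opts B)"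
    (is "_ \<approx> ?H")
  unfolding equivalent_def
proof
  show "?H \<succeq> Game L R"
    using assms not_right_opt_le[of _ "Game L R"] not_right_opt_le[of _ B] ge_trans
    by (intro ge_change_right) (auto, blast)
  have "B \<succeq> ?H"
    using assms(2) not_ge_left_opt[of _ "Game L R"] not_right_opt_le[of _ ?H] ge_trans
    by (intro geI) (auto, blast)
  then have "\<not> ?H \<succeq> A"
    using assms(1) ge_left_opt by blast
  then show "Game L R \<succeq> ?H"
    using not_right_opt_le[of _ ?H] by (intro ge_change_right) auto
qed

text \<open>Options are made canonical by induction. Among the games equivalent to \<open>G\<close>
  whose options are canonical and of height below that of \<open>G\<close>, one with the fewest
  nodes is chosen; a dominated or reversible option would allow a smaller one.\<close>

lemma canonical_form_exists: "\<exists>H. canonical H \<and> height H \<le> height G \<and> G \<approx> H"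
proof (induction G rule: measure_induct_rule[of height])
  case (less G)
  define Q where "Q H \<longleftrightarrow>
    (\<forall>X. is_option X H \<longrightarrow> canonical X \<and> height X < height G) \<and> G \<approx> H" for H
  have "\<exists>f. \<forall>X. is_option X G \<longrightarrow> canonical (f X) \<and> height (f X) \<le> height X \<and> X \<approx> f X"
    using less.IH height_left_opt height_right_opt unfolding is_option_def by meson
  then obtain f where f: "\<And>X. is_option X G \<Longrightarrow> canonical (f X)"
    "\<And>X. is_option X G \<Longrightarrow> height (f X) < height G" "\<And>X. is_option X G \<Longrightarrow> X \<approx> f X"
    by (metis height_left_opt height_right_opt is_option_def le_less_trans)
  have "G \<succeq> Game (f |`| left_opts G) (f |`| right_opts G)" (is "_ \<succeq> ?F")
    using f(3) ge_trans not_ge_left_opt[of _ G] not_right_opt_le[of _ ?F]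
    by (intro geI) (auto simp: is_option_def equivalent_def, blast+)
  moreover have "?F \<succeq> G"
    using f(3) ge_trans not_ge_left_opt[of _ ?F] not_right_opt_le[of _ G]
    by (intro geI) (auto simp: is_option_def equivalent_def, blast+)
  ultimately have "Q ?F"
    using f unfolding Q_def equivalent_def by (auto simp: is_option_def)
  then obtain H where H: "Q H" and min: "\<And>H'. Q H' \<Longrightarrow> nodes H \<le> nodes H'"
    using ex_has_least_nat[of Q ?F nodes] by blast
  obtain L R where LR: "H = Game L R"
    by (cases H)
  \<comment> \<open>Covers both simplifications: \<open>M\<close> empty deletes a dominated option,
    \<open>M = left_opts B\<close> bypasses a reversible one.\<close>
  have Q_left: False
    if A: "A |\<in>| L" and eq: "H \<approx> Game (L |-| {|A|} |\<union>| M) R"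
      and M: "M = {||} \<or> (\<exists>B. B |\<in>| right_opts A \<and> M = left_opts B)" for A M
  proof -
    let ?H = "Game (L |-| {|A|} |\<union>| M) R"
    have opt: "canonical A" "height A < height G"
      using H A LR unfolding Q_def is_option_def by auto
    have "(\<Sum>X\<in>fset M. nodes X) < nodes A"
      using M
    proof (elim disjE exE conjE)
      fix B assume B: "B |\<in>| right_opts A" "M = left_opts B"
      have "(\<Sum>X\<in>fset M. nodes X) < nodes B"
        using B(2) by (simp add: nodes.simps[of B])
      also have "\<dots> < nodes A"
        using B(1) by (rule nodes_right_less)
      finally show ?thesis .
    qed (simp add: nodes.simps[of A])
    then have "nodes ?H < nodes H"
      using sum_replace_less[of "fset L" "fset M" A nodes] A LR
      by (simp add: nodes.simps[of "Game L R"] nodes.simps[of ?H])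
    moreover have "canonical X \<and> height X < height G" if X: "X |\<in>| M" for X
    proof -
      obtain B where B: "B |\<in>| right_opts A" "X |\<in>| left_opts B"
        using M X by auto
      then show ?thesis
        using opt canonical_iff[of A] canonical_iff[of B]
          height_right_opt[OF B(1)] height_left_opt[OF B(2)]
        by (simp add: is_option_def)
    qed
    then have "Q ?H"
      using H eq LR ge_trans unfolding Q_def equivalent_def by (auto simp: is_option_def)
    ultimately show False
      using min by fastforce
  qed
  have Q_right: False
    if A: "A |\<in>| R" and eq: "H \<approx> Game L (R |-| {|A|} |\<union>| M)"
      and M: "M = {||} \<or> (\<exists>B. B |\<in>| left_opts A \<and> M = right_opts B)" for A M
  proof -
    let ?H = "Game L (R |-| {|A|} |\<union>| M)"
    have opt: "canonical A" "height A < height G"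
      using H A LR unfolding Q_def is_option_def by auto
    have "(\<Sum>X\<in>fset M. nodes X) < nodes A"
      using M
    proof (elim disjE exE conjE)
      fix B assume B: "B |\<in>| left_opts A" "M = right_opts B"
      have "(\<Sum>X\<in>fset M. nodes X) < nodes B"
        using B(2) by (simp add: nodes.simps[of B])
      also have "\<dots> < nodes A"
        using B(1) by (rule nodes_left_less)
      finally show ?thesis .
    qed (simp add: nodes.simps[of A])
    then have "nodes ?H < nodes H"
      using sum_replace_less[of "fset R" "fset M" A nodes] A LR
      by (simp add: nodes.simps[of "Game L R"] nodes.simps[of ?H])
    moreover have "canonical X \<and> height X < height G" if X: "X |\<in>| M" for X
    proof -
      obtain B where B: "B |\<in>| left_opts A" "X |\<in>| right_opts B"
        using M X by auto
      then show ?thesis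
        using opt canonical_iff[of A] canonical_iff[of B]
          height_left_opt[OF B(1)] height_right_opt[OF B(2)]
        by (simp add: is_option_def)
    qed
    then have "Q ?H"
      using H eq LR ge_trans unfolding Q_def equivalent_def by (auto simp: is_option_def)
    ultimately show False
      using min by fastforce
  qed
  have "reduced H"
    unfolding reduced_def
  proof
    assume "\<exists>A. left_dominated H A \<or> right_dominated H A \<or>
      left_reversible H A \<or> right_reversible H A"
    then obtain A where "left_dominated H A \<or> right_dominated H A \<or>
      left_reversible H A \<or> right_reversible H A"
      by blast
    then show False
    proof (elim disjE)
      assume A: "left_dominated H A"
      then show False
        using Q_left[of A "{||}"] remove_left_dominated LR by (auto simp: left_dominated_def)
    next
      assume A: "right_dominated H A"
      then show False
        using Q_right[of A "{||}"] remove_right_dominated LR by (auto simp: right_dominated_def)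
    next
      assume "left_reversible H A"
      then obtain B where "A |\<in>| L" "B |\<in>| right_opts A" "H \<succeq> B"
        using LR unfolding left_reversible_def by auto
      then show False
        using Q_left bypass_left_reversible LR by blast
    next
      assume "right_reversible H A"
      then obtain B where "A |\<in>| R" "B |\<in>| left_opts A" "B \<succeq> H"
        using LR unfolding right_reversible_def by auto
      then show False
        using Q_right bypass_right_reversible LR by blast
    qed
  qed
  then have "canonical H"
    using H canonical_iff unfolding Q_def by blast
  moreover have "height H \<le> height G"
    using H height_le_iff unfolding Q_def by blast
  ultimately show ?case
    using H unfolding Q_def by blast
qed


section \<open>Games by their lower and upper cuts\<close>

definition downclosed :: "'a set \<Rightarrow> ('a \<Rightarrow> 'a \<Rightarrow> bool) \<Rightarrow> 'a set \<Rightarrow> bool" where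
  "downclosed P le D \<longleftrightarrow> D \<subseteq> P \<and> (\<forall>x\<in>D. \<forall>y\<in>P. le y x \<longrightarrow> y \<in> D)"

definition cuts :: "'a set \<Rightarrow> ('a \<Rightarrow> 'a \<Rightarrow> bool) \<Rightarrow> ('a set \<times> 'a set) set" where
  "cuts P le = {(D, E). downclosed P le D \<and> downclosed P le E \<and> (\<forall>x\<in>D. \<forall>y\<in>P - E. le x y)}"

definition cut_le :: "'a set \<times> 'a set \<Rightarrow> 'a set \<times> 'a set \<Rightarrow> bool" where
  "cut_le p q \<longleftrightarrow> fst p \<subseteq> fst q \<and> snd p \<subseteq> snd q"

text \<open>\<open>e\<close> maps a form to its value; by antisymmetry, forms equal in the game
  order share one image. The carrier type is left open so that values may be pairs of sets or, for
  evaluation, bit lists.\<close>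

definition represents_day :: "nat \<Rightarrow> 'a set \<Rightarrow> ('a \<Rightarrow> 'a \<Rightarrow> bool) \<Rightarrow> (game \<Rightarrow> 'a) \<Rightarrow> bool" where
  "represents_day n P le e \<longleftrightarrow>
     e ` {G. height G \<le> n} = P \<and>
     (\<forall>G H. height G \<le> n \<longrightarrow> height H \<le> n \<longrightarrow> (le (e G) (e H) \<longleftrightarrow> H \<succeq> G)) \<and>
     (\<forall>x\<in>P. \<forall>y\<in>P. le x y \<longrightarrow> le y x \<longrightarrow> x = y)"

context
  fixes n :: nat and P :: "'a set" and le :: "'a \<Rightarrow> 'a \<Rightarrow> bool" and e :: "game \<Rightarrow> 'a"
  assumes rep: "represents_day n P le e"
begin

lemma represents_day_image: "height G \<le> n \<Longrightarrow> e G \<in> P"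
  using rep unfolding represents_day_def by blast

lemma represents_day_le:
  "height G \<le> n \<Longrightarrow> height H \<le> n \<Longrightarrow> le (e G) (e H) \<longleftrightarrow> H \<succeq> G"
  using rep unfolding represents_day_def by blast

lemma represents_day_antisym: "x \<in> P \<Longrightarrow> y \<in> P \<Longrightarrow> le x y \<Longrightarrow> le y x \<Longrightarrow> x = y"
  using rep unfolding represents_day_def by blast

lemma represents_day_obtain:
  assumes "x \<in> P"
  obtains G where "height G \<le> n" "x = e G"
  using assms rep unfolding represents_day_def by blast

lemma represents_day_eq:
  "height G \<le> n \<Longrightarrow> height H \<le> n \<Longrightarrow> e G = e H \<Longrightarrow> G \<succeq> H"
  using represents_day_le[of H G] represents_day_le[of H H] ge_refl by simp

lemma represents_day_refl: "x \<in> P \<Longrightarrow> le x x"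
  by (metis ge_refl represents_day_le represents_day_obtain)

lemma represents_day_trans:
  assumes "x \<in> P" "y \<in> P" "z \<in> P" "le x y" "le y z"
  shows "le x z"
proof -
  obtain X Y Z where "height X \<le> n" "x = e X" "height Y \<le> n" "y = e Y"
    "height Z \<le> n" "z = e Z"
    using assms(1-3) represents_day_obtain by metis
  then show ?thesis
    using assms(4,5) represents_day_le ge_trans[of Z Y X] by simp
qed

lemma represents_day_finite: "finite P"
  using rep finite_height_le unfolding represents_day_def by blast

text \<open>Uniqueness of canonical forms makes \<open>e\<close> injective on them; existence, at no
  greater height, makes it onto.\<close>

lemma card_canonical_games: "card (canonical_games n) = card P"
proof -
  have "inj_on e (canonical_games n)"
  proof (rule inj_onI)
    fix G H assume *: "G \<in> canonical_games n" "H \<in> canonical_games n" "e G = e H"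
    then have "G \<succeq> H" "H \<succeq> G"
      using represents_day_le[of G H] represents_day_le[of H G] represents_day_le[of G G] ge_refl
      unfolding canonical_games_def by auto
    then show "G = H"
      using * canonical_unique unfolding canonical_games_def by blast
  qed
  moreover have "e ` canonical_games n = P"
  proof
    show "e ` canonical_games n \<subseteq> P"
      using represents_day_image unfolding canonical_games_def by blast
    show "P \<subseteq> e ` canonical_games n"
    proof
      fix x assume x: "x \<in> P"
      then obtain G where G: "height G \<le> n" "x = e G"
        by (rule represents_day_obtain)
      obtain H where H: "canonical H" "height H \<le> height G" "G \<approx> H"
        using canonical_form_exists by blast
      then have "height H \<le> n"
        using G by simp
      moreover from this have "e H = x"
        using G H(3) represents_day_le represents_day_image
        by (intro represents_day_antisym) (simp_all add: equivalent_def)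
      ultimately show "x \<in> e ` canonical_games n"
        using H unfolding canonical_games_def by blast
    qed
  qed
  ultimately show ?thesis
    by (metis card_image)
qed

text \<open>Completeness of the lattice of values born by day \<open>n\<close>. The witness collects
  the left options of the games with value in \<open>D\<close> and the right options of those with
  value in \<open>U\<close>; using their options rather than the games themselves keeps its height
  at most \<open>n\<close>.\<close>

lemma represents_day_interpolate:
  assumes "D \<subseteq> P" "U \<subseteq> P" and DU: "\<And>d u. d \<in> D \<Longrightarrow> u \<in> U \<Longrightarrow> le d u"
  shows "\<exists>m\<in>P. (\<forall>d\<in>D. le d m) \<and> (\<forall>u\<in>U. le m u)"
proof -
  let ?S = "{G. height G \<le> n}"
  define LL where "LL = (\<Union>X\<in>{X \<in> ?S. e X \<in> D}. fset (left_opts X))"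
  define RR where "RR = (\<Union>X\<in>{X \<in> ?S. e X \<in> U}. fset (right_opts X))"
  have "finite LL" "finite RR"
    using finite_height_le[of n] unfolding LL_def RR_def by auto
  then obtain L R where LR: "fset L = LL" "fset R = RR"
    by (metis fset_cases mem_Collect_eq)
  let ?G = "Game L R"
  have left: "\<And>X. X |\<in>| L \<longleftrightarrow> (\<exists>Y. height Y \<le> n \<and> e Y \<in> D \<and> X |\<in>| left_opts Y)"
    and right: "\<And>X. X |\<in>| R \<longleftrightarrow> (\<exists>Y. height Y \<le> n \<and> e Y \<in> U \<and> X |\<in>| right_opts Y)"
    using LR unfolding LL_def RR_def by auto
  have G: "height ?G \<le> n"
    unfolding height_le_iff
    using left right height_left_opt height_right_opt
    by (fastforce simp: is_option_def)
  have le: "Y \<succeq> X" if "height X \<le> n" "height Y \<le> n" "e X \<in> D" "e Y \<in> U" for X Y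
    using that DU represents_day_le by blast
  \<comment> \<open>A left option of \<open>X\<close> is one of \<open>?G\<close>; a right option of
    \<open>?G\<close> belongs to some \<open>Z\<close> above \<open>X\<close> and hence is not below
    \<open>X\<close>.\<close>
  have lower: "?G \<succeq> X" if X: "height X \<le> n" "e X \<in> D" for X
  proof (rule geI)
    fix Y assume "Y |\<in>| right_opts ?G"
    then obtain Z where Z: "height Z \<le> n" "e Z \<in> U" "Y |\<in>| right_opts Z"
      using right by auto
    then show "\<not> X \<succeq> Y"
      using le[of X Z] X ge_right_opt by blast
  next
    fix Y assume "Y |\<in>| left_opts X"
    then have "Y |\<in>| left_opts ?G"
      using left X by auto
    then show "\<not> Y \<succeq> ?G"
      by (rule not_ge_left_opt)
  qed
  have upper: "X \<succeq> ?G" if X: "height X \<le> n" "e X \<in> U" for X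
  proof (rule geI)
    fix Y assume "Y |\<in>| left_opts ?G"
    then obtain Z where Z: "height Z \<le> n" "e Z \<in> D" "Y |\<in>| left_opts Z"
      using left by auto
    then show "\<not> Y \<succeq> X"
      using le[of Z X] X ge_left_opt by blast
  next
    fix Y assume "Y |\<in>| right_opts X"
    then have "Y |\<in>| right_opts ?G"
      using right X by auto
    then show "\<not> ?G \<succeq> Y"
      by (rule not_right_opt_le)
  qed
  have "le d (e ?G)" if d: "d \<in> D" for d
  proof -
    obtain X where "height X \<le> n" "d = e X"
      using d assms(1) represents_day_obtain by blast
    then show ?thesis
      using d lower[of X] represents_day_le[of X ?G] G by simp
  qed
  moreover have "le (e ?G) u" if u: "u \<in> U" for u
  proof -
    obtain X where "height X \<le> n" "u = e X"
      using u assms(2) represents_day_obtain by blast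
    then show ?thesis
      using u upper[of X] represents_day_le[of ?G X] G by simp
  qed
  ultimately show ?thesis
    using represents_day_image[OF G] by blast
qed

section \<open>The correspondence between games and cuts\<close>

definition cut_of :: "game \<Rightarrow> 'a set \<times> 'a set" where
  "cut_of G = (e ` {X. height X \<le> n \<and> G \<succeq> X}, e ` {X. height X \<le> n \<and> \<not> X \<succeq> G})"

lemma in_fst_cut_of:
  assumes "height X \<le> n"
  shows "e X \<in> fst (cut_of G) \<longleftrightarrow> G \<succeq> X"
proof
  assume "e X \<in> fst (cut_of G)"
  then obtain Y where "height Y \<le> n" "G \<succeq> Y" "e X = e Y"
    unfolding cut_of_def by auto
  then show "G \<succeq> X"
    using represents_day_eq[of Y X] assms ge_trans[of G Y X] by simp
qed (use assms in \<open>auto simp: cut_of_def\<close>)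

lemma in_snd_cut_of:
  assumes "height X \<le> n"
  shows "e X \<in> snd (cut_of G) \<longleftrightarrow> \<not> X \<succeq> G"
proof
  assume "e X \<in> snd (cut_of G)"
  then obtain Y where "height Y \<le> n" "\<not> Y \<succeq> G" "e X = e Y"
    unfolding cut_of_def by auto
  then show "\<not> X \<succeq> G"
    using represents_day_eq[of Y X] assms ge_trans[of Y X G] by auto
qed (use assms in \<open>auto simp: cut_of_def\<close>)

lemma cut_of_subset: "fst (cut_of G) \<subseteq> P" "snd (cut_of G) \<subseteq> P"
  unfolding cut_of_def using represents_day_image by auto

lemma cut_of_in_cuts: "cut_of G \<in> cuts P le"
proof -
  let ?D = "fst (cut_of G)" and ?E = "snd (cut_of G)"
  have lower: "y \<in> ?D" if x: "x \<in> ?D" and y: "y \<in> P" "le y x" for x y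
  proof -
    obtain X where X: "height X \<le> n" "x = e X"
      using x cut_of_subset represents_day_obtain by blast
    obtain Y where Y: "height Y \<le> n" "y = e Y"
      using y represents_day_obtain by blast
    show ?thesis
      using X Y x y in_fst_cut_of represents_day_le[of Y X] ge_trans[of G X Y] by simp
  qed
  have upper: "y \<in> ?E" if x: "x \<in> ?E" and y: "y \<in> P" "le y x" for x y
  proof -
    obtain X where X: "height X \<le> n" "x = e X"
      using x cut_of_subset represents_day_obtain by blast
    obtain Y where Y: "height Y \<le> n" "y = e Y"
      using y represents_day_obtain by blast
    show ?thesis
      using X Y x y in_snd_cut_of represents_day_le[of Y X] ge_trans[of X Y G] by auto
  qed
  have cross: "le x y" if x: "x \<in> ?D" and y: "y \<in> P - ?E" for x y
  proof -
    obtain X where X: "height X \<le> n" "x = e X"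
      using x cut_of_subset represents_day_obtain by blast
    obtain Y where Y: "height Y \<le> n" "y = e Y"
      using y represents_day_obtain by blast
    show ?thesis
      using X Y x y in_fst_cut_of in_snd_cut_of represents_day_le[of X Y] ge_trans[of Y G X]
      by simp
  qed
  have "(?D, ?E) \<in> cuts P le"
    unfolding cuts_def downclosed_def
    using cut_of_subset lower upper cross by blast
  then show ?thesis
    by simp
qed

text \<open>Comparing \<open>G\<close> and \<open>H\<close> only tests their options, which are born
  by day \<open>n\<close> and so are visible in the cuts. A right option \<open>X\<close> of
  \<open>H\<close> below \<open>G\<close> would lie in the first component for \<open>G\<close>,
  hence in that for \<open>H\<close>, which is impossible.\<close>

lemma cut_of_mono_iff:
  assumes "height G \<le> Suc n" "height H \<le> Suc n"
  shows "cut_le (cut_of G) (cut_of H) \<longleftrightarrow> H \<succeq> G"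
proof
  assume "H \<succeq> G"
  then show "cut_le (cut_of G) (cut_of H)"
    unfolding cut_le_def cut_of_def fst_conv snd_conv
    by (intro conjI image_mono Collect_mono) (blast intro: ge_trans)+
next
  assume *: "cut_le (cut_of G) (cut_of H)"
  show "H \<succeq> G"
  proof (rule geI)
    fix X assume X: "X |\<in>| right_opts H"
    then have "height X \<le> n"
      using assms(2) height_right_opt[OF X] by simp
    then show "\<not> G \<succeq> X"
      using * in_fst_cut_of not_right_opt_le[OF X] unfolding cut_le_def by blast
  next
    fix X assume X: "X |\<in>| left_opts G"
    then have "height X \<le> n"
      using assms(1) height_left_opt[OF X] by simp
    then show "\<not> X \<succeq> H"
      using * in_snd_cut_of not_ge_left_opt[OF X] unfolding cut_le_def by blast
  qed
qed

text \<open>A cut \<open>(D, E)\<close> is realised by the game whose left options are all of \<open>E\<close> and whose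
  right options are everything outside \<open>D\<close>.\<close>

lemma cut_of_surj:
  assumes "(D, E) \<in> cuts P le"
  shows "\<exists>G. height G \<le> Suc n \<and> cut_of G = (D, E)"
proof -
  let ?S = "{G. height G \<le> n}"
  have cut: "downclosed P le D" "downclosed P le E" "\<forall>x\<in>D. \<forall>y\<in>P - E. le x y"
    using assms unfolding cuts_def by simp_all
  have D: "y \<in> D" if "x \<in> D" "y \<in> P" "le y x" for x y
    using cut(1) that unfolding downclosed_def by blast
  have "D \<subseteq> P" "E \<subseteq> P"
    using cut(1,2) unfolding downclosed_def by blast+
  have E: "y \<in> E" if "x \<in> E" "y \<in> P" "le y x" for x y
    using cut(2) that unfolding downclosed_def by blast
  have DE: "le x y" if "x \<in> D" "y \<in> P" "y \<notin> E" for x y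
    using cut(3) that by blast
  have "finite {X \<in> ?S. e X \<in> E}" "finite {X \<in> ?S. e X \<notin> D}"
    using finite_height_le[of n] by auto
  then obtain L R where "fset L = {X \<in> ?S. e X \<in> E}" "fset R = {X \<in> ?S. e X \<notin> D}"
    by (metis (no_types, lifting) fset_cases mem_Collect_eq)
  then have left: "\<And>X. X |\<in>| L \<longleftrightarrow> height X \<le> n \<and> e X \<in> E"
    and right: "\<And>X. X |\<in>| R \<longleftrightarrow> height X \<le> n \<and> e X \<notin> D"
    by auto
  let ?G = "Game L R"
  have "height ?G \<le> Suc n"
    unfolding height_le_iff using left right by (auto simp: is_option_def less_Suc_eq_le)
  have below: "e X \<in> D" if "height X \<le> n" "?G \<succeq> X" for X
    using that right[of X] not_right_opt_le[of X ?G] by auto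
  have above: "e X \<notin> E" if "height X \<le> n" "X \<succeq> ?G" for X
    using that left[of X] not_ge_left_opt[of X ?G] by auto
  have "X \<succeq> ?G" if X: "height X \<le> n" "e X \<notin> E" for X
  proof (rule geI)
    fix Y assume Y: "Y |\<in>| right_opts X"
    then have hY: "height Y \<le> n"
      using X height_right_opt[OF Y] by simp
    \<comment> \<open>If \<open>?G \<succeq> Y\<close>, then \<open>Y\<close> has its value in
      \<open>D\<close>; that of \<open>X\<close> is outside \<open>E\<close>, so the cut condition
      gives \<open>X \<succeq> Y\<close>, impossible for a right option of \<open>X\<close>.\<close>
    show "\<not> ?G \<succeq> Y"
    proof
      assume "?G \<succeq> Y"
      then have "le (e Y) (e X)"
        using below hY DE X represents_day_image by blast
      then show False
        using represents_day_le hY X not_right_opt_le[OF Y] by blast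
    qed
  next
    fix Y assume "Y |\<in>| left_opts ?G"
    then have "height Y \<le> n" "e Y \<in> E"
      using left by auto
    then show "\<not> Y \<succeq> X"
      using E X represents_day_image represents_day_le by blast
  qed
  then have "e X \<in> snd (cut_of ?G) \<longleftrightarrow> e X \<in> E" if "height X \<le> n" for X
    using that above in_snd_cut_of by blast
  then have snd: "snd (cut_of ?G) = E"
    using cut_of_subset(2)[of ?G] \<open>E \<subseteq> P\<close> represents_day_obtain by blast
  have "?G \<succeq> X" if X: "height X \<le> n" "e X \<in> D" for X
  proof (rule geI)
    fix Y assume Y: "Y |\<in>| left_opts X"
    then have hY: "height Y \<le> n"
      using X height_left_opt[OF Y] by simp
    show "\<not> Y \<succeq> ?G"
    proof
      assume "Y \<succeq> ?G"
      then have "le (e X) (e Y)"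
        using above hY DE X represents_day_image by blast
      then show False
        using represents_day_le hY X not_ge_left_opt[OF Y] by blast
    qed
  next
    fix Y assume "Y |\<in>| right_opts ?G"
    then have "height Y \<le> n" "e Y \<notin> D"
      using right by auto
    then show "\<not> X \<succeq> Y"
      using D X represents_day_image represents_day_le by blast
  qed
  then have "e X \<in> fst (cut_of ?G) \<longleftrightarrow> e X \<in> D" if "height X \<le> n" for X
    using that below in_fst_cut_of by blast
  then have fst: "fst (cut_of ?G) = D"
    using cut_of_subset(1)[of ?G] \<open>D \<subseteq> P\<close> represents_day_obtain by blast
  show ?thesis
    using \<open>height ?G \<le> Suc n\<close> fst snd by (metis prod.collapse)
qed

lemma represents_day_cuts: "represents_day (Suc n) (cuts P le) cut_le cut_of"
  unfolding represents_day_def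
proof (intro conjI allI impI ballI)
  show "cut_of ` {G. height G \<le> Suc n} = cuts P le"
  proof
    show "cut_of ` {G. height G \<le> Suc n} \<subseteq> cuts P le"
      using cut_of_in_cuts by blast
    show "cuts P le \<subseteq> cut_of ` {G. height G \<le> Suc n}"
    proof clarify
      fix D E assume "(D, E) \<in> cuts P le"
      then obtain G where "height G \<le> Suc n" "cut_of G = (D, E)"
        using cut_of_surj by blast
      then show "(D, E) \<in> cut_of ` {G. height G \<le> Suc n}"
        by (intro image_eqI[of _ _ G]) auto
    qed
  qed
next
  fix G H assume "height G \<le> Suc n" "height H \<le> Suc n"
  then show "cut_le (cut_of G) (cut_of H) \<longleftrightarrow> H \<succeq> G"
    by (rule cut_of_mono_iff)
next
  fix x y :: "'a set \<times> 'a set" assume "cut_le x y" "cut_le y x"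
  then show "x = y"
    unfolding cut_le_def by (auto simp: prod_eq_iff)
qed

text \<open>Serves to pass from pairs of sets to bit lists, on which the order can be
  evaluated.\<close>

lemma represents_day_relabel:
  assumes "\<And>x y. x \<in> P \<Longrightarrow> y \<in> P \<Longrightarrow> le' (f x) (f y) \<longleftrightarrow> le x y"
  shows "represents_day n (f ` P) le' (f \<circ> e)"
  unfolding represents_day_def
proof (intro conjI allI impI ballI)
  have "e ` {G. height G \<le> n} = P"
    using rep unfolding represents_day_def by (rule conjunct1)
  then show "(f \<circ> e) ` {G. height G \<le> n} = f ` P"
    by (simp only: image_comp[symmetric])
next
  fix G H assume "height G \<le> n" "height H \<le> n"
  then show "le' ((f \<circ> e) G) ((f \<circ> e) H) \<longleftrightarrow> H \<succeq> G"
    using assms[of "e G" "e H"] represents_day_image represents_day_le[of G H] by simp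
next
  fix x y assume *: "x \<in> f ` P" "y \<in> f ` P" "le' x y" "le' y x"
  then obtain x' y' where "x' \<in> P" "x = f x'" "y' \<in> P" "y = f y'"
    by blast
  then show "x = y"
    using * assms represents_day_antisym[of x' y'] by simp
qed

end

section \<open>Bounds on the number of cuts\<close>

lemma finite_downclosed: "finite P \<Longrightarrow> finite {D. downclosed P le D}"
  unfolding downclosed_def by (rule finite_subset[of _ "Pow P"]) auto

text \<open>Down-sets of a chain are nested, so their cardinality determines them.\<close>

lemma card_downclosed_chain:
  assumes "finite C" and chain: "\<forall>x\<in>C. \<forall>y\<in>C. le x y \<or> le y x"
  shows "card {D. downclosed C le D} \<le> Suc (card C)"
proof -
  have "inj_on card {D. downclosed C le D}"
  proof (rule inj_onI)
    fix D D' assume D: "D \<in> {D. downclosed C le D}" "D' \<in> {D. downclosed C le D}" "card D = card D'"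
    then have "finite D" "finite D'"
      using assms(1) finite_subset unfolding downclosed_def by blast+
    moreover have "D \<subseteq> D' \<or> D' \<subseteq> D"
      using D chain unfolding downclosed_def by blast
    ultimately show "D = D'"
      using D(3) card_subset_eq by metis
  qed
  moreover have "card ` {D. downclosed C le D} \<subseteq> {..card C}"
    using assms(1) card_mono unfolding downclosed_def by auto
  ultimately show ?thesis
    using card_inj_on_le[of card _ "{..card C}"] by simp
qed

text \<open>Induction on the list of chains: \<open>D\<close> is determined by its parts inside and
  outside the first chain. The chains may overlap or reach outside \<open>Q\<close>; only their
  traces on \<open>Q\<close> are counted.\<close>

lemma card_downclosed_le:
  assumes "finite Q" "Q \<subseteq> \<Union>(set Cs)"
    and "\<And>C. C \<in> set Cs \<Longrightarrow> \<forall>x\<in>C. \<forall>y\<in>C. le x y \<or> le y x"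
  shows "card {D. downclosed Q le D} \<le> (\<Prod>C\<leftarrow>Cs. Suc (card (C \<inter> Q)))"
  using assms
proof (induction Cs arbitrary: Q)
  case Nil
  then have "{D. downclosed Q le D} = {{}}"
    unfolding downclosed_def by auto
  then show ?case
    by simp
next
  case (Cons C Cs)
  let ?A = "{D. downclosed (C \<inter> Q) le D}" and ?B = "{D. downclosed (Q - C) le D}"
  have "card {D. downclosed Q le D} \<le> card (?A \<times> ?B)"
  proof (rule card_inj_on_le)
    show "inj_on (\<lambda>D. (D \<inter> C, D - C)) {D. downclosed Q le D}"
      by (rule inj_onI) blast
    show "(\<lambda>D. (D \<inter> C, D - C)) ` {D. downclosed Q le D} \<subseteq> ?A \<times> ?B"
      unfolding downclosed_def by auto
    show "finite (?A \<times> ?B)"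
      using Cons.prems(1) by (intro finite_cartesian_product finite_downclosed) auto
  qed
  also have "\<dots> = card ?A * card ?B"
    by (rule card_cartesian_product)
  also have "\<dots> \<le> Suc (card (C \<inter> Q)) * (\<Prod>C'\<leftarrow>Cs. Suc (card (C' \<inter> Q)))"
  proof (rule mult_le_mono)
    show "card ?A \<le> Suc (card (C \<inter> Q))"
      using Cons.prems by (intro card_downclosed_chain) auto
    have "card ?B \<le> (\<Prod>C'\<leftarrow>Cs. Suc (card (C' \<inter> (Q - C))))"
      using Cons.prems by (intro Cons.IH) auto
    also have "\<dots> \<le> (\<Prod>C'\<leftarrow>Cs. Suc (card (C' \<inter> Q)))"
    proof (induction Cs)
      case (Cons C' Cs)
      have "card (C' \<inter> (Q - C)) \<le> card (C' \<inter> Q)"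
        using \<open>finite Q\<close> by (intro card_mono) auto
      then show ?case
        using Cons by (simp del: mult_Suc add: mult_le_mono)
    qed simp
    finally show "card ?B \<le> (\<Prod>C'\<leftarrow>Cs. Suc (card (C' \<inter> Q)))" .
  qed
  finally show ?case
    by simp
qed

text \<open>The inequality of arithmetic and geometric means for \<open>a + 1\<close> and
  \<open>b + 1\<close>, whose sum is at most \<open>k + 3\<close>.\<close>

lemma Suc_mult_Suc_le:
  assumes "a + b \<le> Suc k"
  shows "real (Suc a * Suc b) \<le> (real k + 3)\<^sup>2 / 4"
proof -
  have "4 * (real (Suc a) * real (Suc b)) = (real a + real b + 2)\<^sup>2 - (real a - real b)\<^sup>2"
    by (simp add: power2_eq_square algebra_simps)
  also have "\<dots> \<le> (real a + real b + 2)\<^sup>2"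
    by simp
  also have "\<dots> \<le> (real k + 3)\<^sup>2"
    using assms by (intro power_mono) linarith+
  finally have "4 * (real (Suc a) * real (Suc b)) \<le> (real k + 3)\<^sup>2" .
  then show ?thesis
    unfolding of_nat_mult by linarith
qed

text \<open>A cut \<open>(D, E)\<close> is split at an element \<open>m\<close> between \<open>D\<close> and the complement of \<open>E\<close>.
  Since a chain meets the sets below and above \<open>m\<close> in at most one common element, the traces of
  \<open>D\<close> and \<open>E\<close> on a chain with \<open>k\<close> elements can be chosen in at most \<open>(k + 3)\<^sup>2 / 4\<close> ways.\<close>

lemma card_cuts_le:
  fixes le :: "'a \<Rightarrow> 'a \<Rightarrow> bool"
  assumes "finite P"
    and antisym: "\<And>x y. x \<in> P \<Longrightarrow> y \<in> P \<Longrightarrow> le x y \<Longrightarrow> le y x \<Longrightarrow> x = y"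
    and interpolate: "\<And>D U. D \<subseteq> P \<Longrightarrow> U \<subseteq> P \<Longrightarrow> (\<And>d u. d \<in> D \<Longrightarrow> u \<in> U \<Longrightarrow> le d u) \<Longrightarrow>
      \<exists>m\<in>P. (\<forall>d\<in>D. le d m) \<and> (\<forall>u\<in>U. le m u)"
    and cover: "P = \<Union>(set Cs)"
    and chains: "list_all2 (\<lambda>C k. (\<forall>x\<in>C. \<forall>y\<in>C. le x y \<or> le y x) \<and> card C \<le> k) Cs ks"
  shows "real (card (cuts P le)) \<le> real (sum_list ks) * (\<Prod>k\<leftarrow>ks. (real k + 3)\<^sup>2 / 4)"
proof -
  \<comment> \<open>\<open>A m\<close> holds the candidates for \<open>D\<close>, and
    \<open>B m\<close> those for the complement of \<open>E\<close>. An up-set is a down-set of the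
    reversed order, so one counting lemma serves both.\<close>
  define A where "A m = {D. downclosed {x \<in> P. le x m} le D}" for m
  define B where "B m = {U. downclosed {x \<in> P. le m x} (\<lambda>x y. le y x) U}" for m
  have fin: "finite (A m)" "finite (B m)" for m
    unfolding A_def B_def using assms(1) by (intro finite_downclosed; simp)+
  have "cuts P le \<subseteq> (\<Union>m\<in>P. (\<lambda>(D, U). (D, P - U)) ` (A m \<times> B m))"
  proof
    fix p assume p: "p \<in> cuts P le"
    obtain D E where DE: "p = (D, E)"
      by (cases p)
    have cut: "downclosed P le D" "downclosed P le E" "\<forall>x\<in>D. \<forall>y\<in>P - E. le x y"
      using p DE unfolding cuts_def by simp_all
    then have D: "D \<subseteq> P" "E \<subseteq> P"
      unfolding downclosed_def by blast+
    obtain m where m: "m \<in> P" "\<And>d. d \<in> D \<Longrightarrow> le d m" "\<And>u. u \<in> P - E \<Longrightarrow> le m u"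
      using interpolate[of D "P - E"] D(1) cut(3) by blast
    have "D \<in> A m"
      using cut(1) m(2) unfolding A_def downclosed_def by blast
    moreover have "P - E \<in> B m"
      using cut(2) m(3) unfolding B_def downclosed_def by blast
    moreover have "p = (\<lambda>(D, U). (D, P - U)) (D, P - E)"
      using DE D by auto
    ultimately show "p \<in> (\<Union>m\<in>P. (\<lambda>(D, U). (D, P - U)) ` (A m \<times> B m))"
      using m(1) by blast
  qed
  then have "card (cuts P le) \<le> card (\<Union>m\<in>P. (\<lambda>(D, U). (D, P - U)) ` (A m \<times> B m))"
    using assms(1) fin by (intro card_mono) auto
  also have "\<dots> \<le> (\<Sum>m\<in>P. card ((\<lambda>(D, U). (D, P - U)) ` (A m \<times> B m)))"
    using assms(1) by (rule card_UN_le)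
  also have "\<dots> \<le> (\<Sum>m\<in>P. card (A m) * card (B m))"
  proof (rule sum_mono)
    fix m
    show "card ((\<lambda>(D, U). (D, P - U)) ` (A m \<times> B m)) \<le> card (A m) * card (B m)"
      using card_image_le[OF finite_cartesian_product[OF fin]] by (simp add: card_cartesian_product)
  qed
  finally have "real (card (cuts P le)) \<le> real (\<Sum>m\<in>P. card (A m) * card (B m))"
    by (simp only: of_nat_le_iff)
  also have "\<dots> = (\<Sum>m\<in>P. real (card (A m)) * real (card (B m)))"
    by simp
  also have "\<dots> \<le> (\<Sum>m\<in>P. \<Prod>k\<leftarrow>ks. (real k + 3)\<^sup>2 / 4)"
  proof (rule sum_mono)
    fix m assume m: "m \<in> P"
    have chain: "\<forall>x\<in>C. \<forall>y\<in>C. le x y \<or> le y x" if "C \<in> set Cs" for C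
      using chains that by (induction rule: list_all2_induct) auto
    have sub: "finite {x \<in> P. Q x}" "{x \<in> P. Q x} \<subseteq> \<Union>(set Cs)" for Q
      using assms(1) cover[THEN equalityD1] by (simp, blast)
    have "card (A m) \<le> (\<Prod>C\<leftarrow>Cs. Suc (card (C \<inter> {x \<in> P. le x m})))"
      unfolding A_def using chain by (intro card_downclosed_le[OF sub]) blast
    moreover have "card (B m) \<le> (\<Prod>C\<leftarrow>Cs. Suc (card (C \<inter> {x \<in> P. le m x})))"
      unfolding B_def using chain by (intro card_downclosed_le[OF sub]) blast
    ultimately have "real (card (A m)) * real (card (B m))
      \<le> real (\<Prod>C\<leftarrow>Cs. Suc (card (C \<inter> {x \<in> P. le x m})))
        * real (\<Prod>C\<leftarrow>Cs. Suc (card (C \<inter> {x \<in> P. le m x})))"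
      by (intro mult_mono) (simp_all only: of_nat_le_iff of_nat_0_le_iff)
    \<comment> \<open>The two products are combined chain by chain, because the traces below and
      above \<open>m\<close> limit each other on the same chain.\<close>
    also have "\<dots> \<le> (\<Prod>k\<leftarrow>ks. (real k + 3)\<^sup>2 / 4)"
      using chains cover[THEN equalityD2]
    proof (induction rule: list_all2_induct)
      case (Cons C Cs k ks)
      let ?a = "C \<inter> {x \<in> P. le x m}" and ?b = "C \<inter> {x \<in> P. le m x}"
      have "finite C"
        using Cons.prems assms(1) finite_subset by auto
      then have "card ?a + card ?b = card (?a \<union> ?b) + card (?a \<inter> ?b)"
        by (intro card_Un_Int) auto
      moreover have "card (?a \<union> ?b) \<le> card C"
        using \<open>finite C\<close> by (intro card_mono) auto
      \<comment> \<open>By antisymmetry only \<open>m\<close> can be both below and above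
        \<open>m\<close>; this is the extra one in \<open>Suc k\<close>.\<close>
      moreover have "card (?a \<inter> ?b) \<le> card {m}"
        using m antisym by (intro card_mono) auto
      ultimately have "card ?a + card ?b \<le> Suc k"
        using Cons.hyps by simp
      then have "real (Suc (card ?a) * Suc (card ?b)) \<le> (real k + 3)\<^sup>2 / 4"
        by (rule Suc_mult_Suc_le)
      then have "real (Suc (card ?a) * Suc (card ?b))
          * (real (\<Prod>C\<leftarrow>Cs. Suc (card (C \<inter> {x \<in> P. le x m})))
          * real (\<Prod>C\<leftarrow>Cs. Suc (card (C \<inter> {x \<in> P. le m x}))))
        \<le> (real k + 3)\<^sup>2 / 4 * (\<Prod>k\<leftarrow>ks. (real k + 3)\<^sup>2 / 4)"
        using Cons.IH Cons.prems by (intro mult_mono) auto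
      then show ?case
        by (simp only: list.map prod_list.Cons of_nat_mult mult_ac)
    qed simp
    finally show "real (card (A m)) * real (card (B m)) \<le> (\<Prod>k\<leftarrow>ks. (real k + 3)\<^sup>2 / 4)" .
  qed
  also have "\<dots> = real (card P) * (\<Prod>k\<leftarrow>ks. (real k + 3)\<^sup>2 / 4)"
    by simp
  also have "\<dots> \<le> real (sum_list ks) * (\<Prod>k\<leftarrow>ks. (real k + 3)\<^sup>2 / 4)"
  proof (rule mult_right_mono)
    have "card (\<Union>(set Cs)) \<le> sum_list ks"
      using chains
    proof (induction rule: list_all2_induct)
      case (Cons C Cs k ks)
      then show ?case
        using card_Un_le[of C "\<Union>(set Cs)"] by simp
    qed simp
    then show "real (card P) \<le> real (sum_list ks)"
      using cover by simp
    show "0 \<le> (\<Prod>k\<leftarrow>ks. (real k + 3)\<^sup>2 / 4)"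
      by (induction ks) auto
  qed
  finally show ?thesis .
qed

text \<open>Different pairs of subsets give different cuts, because the antichain \<open>A\<close>
  meets the down-set generated by \<open>S\<close> exactly in \<open>S\<close>, and dually for
  \<open>B\<close>. The cross condition follows from a chain of comparisons x, s, t, y with
  \<open>s\<close> in \<open>S\<close> and \<open>t\<close> in \<open>T\<close>.\<close>

lemma card_cuts_ge:
  assumes "finite P" and refl: "\<And>x. x \<in> P \<Longrightarrow> le x x"
    and trans: "\<And>x y z. x \<in> P \<Longrightarrow> y \<in> P \<Longrightarrow> z \<in> P \<Longrightarrow> le x y \<Longrightarrow> le y z \<Longrightarrow> le x z"
    and "A \<subseteq> P" "B \<subseteq> P" and AB: "\<And>a b. a \<in> A \<Longrightarrow> b \<in> B \<Longrightarrow> le a b"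
    and A: "\<And>x y. x \<in> A \<Longrightarrow> y \<in> A \<Longrightarrow> le x y \<Longrightarrow> x = y"
    and B: "\<And>x y. x \<in> B \<Longrightarrow> y \<in> B \<Longrightarrow> le x y \<Longrightarrow> x = y"
  shows "2 ^ (card A + card B) \<le> card (cuts P le)"
proof -
  define down where "down S = {x \<in> P. \<exists>s\<in>S. le x s}" for S
  define notup where "notup T = {x \<in> P. \<forall>t\<in>T. \<not> le t x}" for T
  have down_sub: "down S \<subseteq> P" "notup S \<subseteq> P" for S
    unfolding down_def notup_def by simp_all
  have down: "down S \<inter> A = S" if "S \<subseteq> A" for S
    using that A refl \<open>A \<subseteq> P\<close> unfolding down_def by blast
  have notup: "B - notup T = T" if "T \<subseteq> B" for T
    using that B refl \<open>B \<subseteq> P\<close> unfolding notup_def by blast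
  have "card (Pow A \<times> Pow B) \<le> card (cuts P le)"
  proof (rule card_inj_on_le)
    show "inj_on (\<lambda>(S, T). (down S, notup T)) (Pow A \<times> Pow B)"
    proof (rule inj_on_inverseI)
      fix p assume "p \<in> Pow A \<times> Pow B"
      then show "(\<lambda>(D, E). (D \<inter> A, B - E)) ((\<lambda>(S, T). (down S, notup T)) p) = p"
        using down notup by auto
    qed
    show "(\<lambda>(S, T). (down S, notup T)) ` (Pow A \<times> Pow B) \<subseteq> cuts P le"
    proof clarify
      fix S T assume ST: "S \<subseteq> A" "T \<subseteq> B"
      then have sub: "S \<subseteq> P" "T \<subseteq> P"
        using \<open>A \<subseteq> P\<close> \<open>B \<subseteq> P\<close> by simp_all
      have "y \<in> down S" if x: "x \<in> down S" and y: "y \<in> P" "le y x" for x y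
      proof -
        obtain s where "s \<in> S" "le x s" "x \<in> P"
          using x unfolding down_def by blast
        then show ?thesis
          using trans[of y x s] y sub unfolding down_def by blast
      qed
      then have "downclosed P le (down S)"
        unfolding downclosed_def using down_sub[of S] by blast
      moreover have "y \<in> notup T" if x: "x \<in> notup T" and y: "y \<in> P" "le y x" for x y
      proof -
        have "\<not> le t y" if "t \<in> T" for t
          using x trans[of t y x] y sub that unfolding notup_def by blast
        then show ?thesis
          using y unfolding notup_def by blast
      qed
      then have "downclosed P le (notup T)"
        unfolding downclosed_def using down_sub(2)[of T] by blast
      moreover have "le x y" if xy: "x \<in> down S" "y \<in> P - notup T" for x y
      proof -
        obtain s t where "s \<in> S" "le x s" "t \<in> T" "le t y" "x \<in> P" "y \<in> P"
          using xy unfolding down_def notup_def by blast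
        then show ?thesis
          using AB[of s t] trans[of x s t] trans[of x t y] ST sub by blast
      qed
      ultimately show "(down S, notup T) \<in> cuts P le"
        unfolding cuts_def by simp
    qed
    show "finite (cuts P le)"
      by (rule finite_subset[of _ "Pow P \<times> Pow P"])
        (use assms(1) in \<open>auto simp: cuts_def downclosed_def\<close>)
  qed
  moreover have "finite A" "finite B"
    using assms finite_subset by blast+
  ultimately show ?thesis
    by (simp add: card_cartesian_product card_Pow power_add)
qed

text \<open>Greedy chain decomposition: a chain is represented by its largest element and its length.
  The functions below that are run by \<open>code_simp\<close> branch by pattern matching on booleans and avoid
  \<open>if\<close>, \<open>filter\<close> and \<open>fold\<close>: after rewriting a conditional the simplifier traverses its whole
  (already normal) result again, which makes the evaluation quadratic.\<close>

fun add_to_chain :: "('a \<Rightarrow> 'a \<Rightarrow> bool) \<Rightarrow> 'a \<Rightarrow> ('a \<times> nat) list \<Rightarrow> ('a \<times> nat) list"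
  and extend_or_pass ::
    "('a \<Rightarrow> 'a \<Rightarrow> bool) \<Rightarrow> bool \<Rightarrow> 'a \<Rightarrow> 'a \<Rightarrow> nat \<Rightarrow> ('a \<times> nat) list \<Rightarrow> ('a \<times> nat) list" where
  "add_to_chain le x [] = [(x, 1)]"
| "add_to_chain le x ((y, k) # cs) = extend_or_pass le (le y x) x y k cs"
| "extend_or_pass le True x y k cs = (x, Suc k) # cs"
| "extend_or_pass le False x y k cs = (y, k) # add_to_chain le x cs"

fun greedy_chains :: "('a \<Rightarrow> 'a \<Rightarrow> bool) \<Rightarrow> 'a list \<Rightarrow> ('a \<times> nat) list \<Rightarrow> ('a \<times> nat) list" where
  "greedy_chains le [] cs = cs"
| "greedy_chains le (x # xs) cs = greedy_chains le xs (add_to_chain le x cs)"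

text \<open>\<open>fst c\<close> is the greatest element of the chain, while \<open>snd c\<close>
  only bounds its length: inserting an element already present raises the counter but not the
  cardinality.\<close>

definition chain_below :: "('a \<Rightarrow> 'a \<Rightarrow> bool) \<Rightarrow> 'a set \<Rightarrow> 'a \<times> nat \<Rightarrow> bool" where
  "chain_below le C c \<longleftrightarrow> finite C \<and> (\<forall>x\<in>C. le x (fst c)) \<and> fst c \<in> C \<and>
     (\<forall>x\<in>C. \<forall>y\<in>C. le x y \<or> le y x) \<and> card C \<le> snd c"

text \<open>Comparing \<open>x\<close> with the top of a chain suffices: if the top is below
  \<open>x\<close>, transitivity puts the whole chain below \<open>x\<close>.\<close>

lemma add_to_chain_cover:
  assumes "list_all2 (chain_below le) Cs cs" "\<Union>(set Cs) \<subseteq> P" "x \<in> P"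
    and refl: "\<And>x. x \<in> P \<Longrightarrow> le x x"
    and trans: "\<And>x y z. x \<in> P \<Longrightarrow> y \<in> P \<Longrightarrow> z \<in> P \<Longrightarrow> le x y \<Longrightarrow> le y z \<Longrightarrow> le x z"
  shows "\<exists>Cs'. list_all2 (chain_below le) Cs' (add_to_chain le x cs) \<and>
    \<Union>(set Cs') = insert x (\<Union>(set Cs))"
  using assms(1,2)
proof (induction rule: list_all2_induct)
  case Nil
  then show ?case
    using refl[OF assms(3)] by (intro exI[of _ "[{x}]"]) (simp add: chain_below_def)
next
  case (Cons C Cs c cs)
  obtain y k where c: "c = (y, k)"
    by (cases c)
  show ?case
  proof (cases "le y x")
    case True
    have "le z x" if "z \<in> C" for z
      using Cons.hyps(1) Cons.prems c True trans[of z y x] assms(3) that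
      unfolding chain_below_def by auto
    then have "chain_below le (insert x C) (x, Suc k)"
      using Cons.hyps(1) c refl[OF assms(3)] unfolding chain_below_def
      by (auto simp: card_insert_if)
    then show ?thesis
      using Cons.hyps(2) c True by (intro exI[of _ "insert x C # Cs"]) simp
  next
    case False
    obtain Cs' where "list_all2 (chain_below le) Cs' (add_to_chain le x cs)"
      "\<Union>(set Cs') = insert x (\<Union>(set Cs))"
      using Cons.IH Cons.prems by auto
    then show ?thesis
      using Cons.hyps(1) c False by (intro exI[of _ "C # Cs'"]) auto
  qed
qed

lemma greedy_chains_cover:
  assumes "list_all2 (chain_below le) Cs cs" "\<Union>(set Cs) \<subseteq> P" "set xs \<subseteq> P"
    and refl: "\<And>x. x \<in> P \<Longrightarrow> le x x"
    and trans: "\<And>x y z. x \<in> P \<Longrightarrow> y \<in> P \<Longrightarrow> z \<in> P \<Longrightarrow> le x y \<Longrightarrow> le y z \<Longrightarrow> le x z"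
  shows "\<exists>Cs'. list_all2 (chain_below le) Cs' (greedy_chains le xs cs) \<and>
    \<Union>(set Cs') = set xs \<union> \<Union>(set Cs)"
  using assms(1-3)
proof (induction xs arbitrary: Cs cs)
  case Nil
  then show ?case
    by (intro exI[of _ Cs]) simp
next
  case (Cons x xs)
  then have "x \<in> P" "set xs \<subseteq> P"
    by simp_all
  have "\<exists>Cs'. list_all2 (chain_below le) Cs' (add_to_chain le x cs) \<and>
      \<Union>(set Cs') = insert x (\<Union>(set Cs))"
    by (rule add_to_chain_cover[OF Cons.prems(1,2) \<open>x \<in> P\<close>]; fact)
  then obtain Cs' where Cs': "list_all2 (chain_below le) Cs' (add_to_chain le x cs)"
    "\<Union>(set Cs') = insert x (\<Union>(set Cs))"
    by blast
  then have "\<Union>(set Cs') \<subseteq> P"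
    using Cons.prems(2) \<open>x \<in> P\<close> by simp
  from Cons.IH[OF Cs'(1) this \<open>set xs \<subseteq> P\<close>] show ?case
    using Cs'(2) by simp
qed

section \<open>The values of day 3 as bit lists\<close>

text \<open>Inclusion of sets given by membership bits. Lists of different lengths are compared on
  their common prefix, so transitivity can fail for them; hence the length conditions in
  \<open>leq_trans\<close>.\<close>

fun leq :: "bool list \<Rightarrow> bool list \<Rightarrow> bool" where
  "leq (False # xs) (y # ys) = leq xs ys"
| "leq (True # xs) (True # ys) = leq xs ys"
| "leq (True # xs) (False # ys) = False"
| "leq [] ys = True"
| "leq xs [] = True"

fun rank :: "bool list \<Rightarrow> nat" where
  "rank [] = 0"
| "rank (True # xs) = Suc (rank xs)"
| "rank (False # xs) = rank xs"

fun keep_if :: "bool \<Rightarrow> 'a \<Rightarrow> 'a list \<Rightarrow> 'a list" where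
  "keep_if True x xs = x # xs"
| "keep_if False x xs = xs"

primrec select :: "('a \<Rightarrow> bool) \<Rightarrow> 'a list \<Rightarrow> 'a list" where
  "select P [] = []"
| "select P (x # xs) = keep_if (P x) x (select P xs)"

lemma select_eq_filter [simp]: "select P xs = filter P xs"
  by (induction xs) auto

text \<open>Tests whether \<open>p\<close>, with membership \<open>v\<close>, may join a down-set of
  \<open>qs\<close> with membership bits \<open>ws\<close>: a member forces everything below it in,
  a nonmember forces everything above it out.\<close>

fun compatible :: "bool list \<Rightarrow> bool \<Rightarrow> bool list list \<Rightarrow> bool list \<Rightarrow> bool" where
  "compatible p True (q # qs) (True # ws) = compatible p True qs ws"
| "compatible p True (q # qs) (False # ws) = (\<not> leq q p \<and> compatible p True qs ws)"
| "compatible p False (q # qs) (True # ws) = (\<not> leq p q \<and> compatible p False qs ws)"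
| "compatible p False (q # qs) (False # ws) = compatible p False qs ws"
| "compatible p v qs ws = True"

fun downsets :: "bool list list \<Rightarrow> bool list list" where
  "downsets [] = [[]]"
| "downsets (p # ps) =
     (let bs = downsets ps
      in map (Cons False) (select (compatible p False ps) bs) @
         map (Cons True) (select (compatible p True ps) bs))"

fun some_not_leq :: "bool list list \<Rightarrow> bool list \<Rightarrow> bool list \<Rightarrow> bool" where
  "some_not_leq (p # ps) (True # bs) y = (\<not> leq p y \<or> some_not_leq ps bs y)"
| "some_not_leq (p # ps) (False # bs) y = some_not_leq ps bs y"
| "some_not_leq _ _ y = False"

text \<open>Elements that are not above all of \<open>d\<close> must lie in the second component, so
  the cross condition becomes a single comparison of bit lists.\<close>

definition cuts_from :: "bool list list \<Rightarrow> bool list list \<Rightarrow> bool list \<Rightarrow> bool list list" where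
  "cuts_from ps ds d = map (append d) (select (leq (map (some_not_leq ps d) ps)) ds)"

definition cut_list :: "bool list list \<Rightarrow> bool list list" where
  "cut_list ps = (let ds = downsets ps in concat (map (cuts_from ps ds) ds))"

primrec value_list :: "nat \<Rightarrow> bool list list" where
  "value_list 0 = [[]]"
| "value_list (Suc n) = cut_list (value_list n)"

section \<open>Correctness of the enumeration\<close>

definition bits :: "'a list \<Rightarrow> 'a set \<Rightarrow> bool list" where
  "bits ps D = map (\<lambda>p. p \<in> D) ps"

definition encode :: "'a list \<Rightarrow> 'a set \<times> 'a set \<Rightarrow> bool list" where
  "encode ps p = bits ps (fst p) @ bits ps (snd p)"

lemma length_bits [simp]: "length (bits ps D) = length ps"
  by (simp add: bits_def)

lemma leq_map: "leq (map f ps) (map g ps) \<longleftrightarrow> (\<forall>p\<in>set ps. f p \<longrightarrow> g p)"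
proof (induction ps)
  case (Cons p ps)
  then show ?case
    by (cases "f p"; cases "g p") auto
qed simp

lemma leq_append:
  "length xs = length ys \<Longrightarrow> leq (xs @ us) (ys @ vs) \<longleftrightarrow> leq xs ys \<and> leq us vs"
proof (induction xs ys rule: list_induct2)
  case (Cons x xs y ys)
  then show ?case
    by (cases x; cases y) auto
qed simp

lemma leq_trans:
  "length xs = length ys \<Longrightarrow> length ys = length zs \<Longrightarrow> leq xs ys \<Longrightarrow> leq ys zs \<Longrightarrow> leq xs zs"
proof (induction xs ys zs rule: list_induct3)
  case (Cons x xs y ys z zs)
  then show ?case
    by (cases x; cases y; cases z) auto
qed simp

text \<open>Makes each rank level an antichain, which is how the antichains of the lower bound are
  obtained.\<close>

lemma leq_rank:
  "length xs = length ys \<Longrightarrow> leq xs ys \<Longrightarrow> rank xs \<le> rank ys \<and> (rank xs = rank ys \<longrightarrow> xs = ys)"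
proof (induction xs ys rule: list_induct2)
  case (Cons x xs y ys)
  then show ?case
    by (cases x; cases y) auto
qed simp

lemma leq_encode:
  assumes "fst p \<subseteq> set ps" "snd p \<subseteq> set ps"
  shows "leq (encode ps p) (encode ps q) \<longleftrightarrow> cut_le p q"
  using assms unfolding encode_def bits_def cut_le_def by (auto simp: leq_append leq_map)

lemma compatible_map:
  "compatible p v ps (map g ps) \<longleftrightarrow>
     (\<forall>q\<in>set ps. (v \<and> leq q p \<longrightarrow> g q) \<and> (g q \<and> leq p q \<longrightarrow> v))"
proof (induction ps)
  case (Cons q ps)
  then show ?case
    by (cases v; cases "g q") auto
qed simp

lemma some_not_leq_map:
  "some_not_leq ps (map g ps) y \<longleftrightarrow> (\<exists>p\<in>set ps. g p \<and> \<not> leq p y)"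
proof (induction ps)
  case (Cons p ps)
  then show ?case
    by (cases "g p") auto
qed simp

text \<open>Stated so that the last conjunct matches \<open>compatible_map\<close>, with
  \<open>v\<close> as \<open>p \<in> D\<close> and \<open>g\<close> as membership in
  \<open>D - {p}\<close>.\<close>

lemma downclosed_insert:
  assumes "p \<notin> P"
  shows "downclosed (insert p P) le D \<longleftrightarrow>
    D \<subseteq> insert p P \<and> downclosed P le (D - {p}) \<and>
    (\<forall>q\<in>P. (p \<in> D \<and> le q p \<longrightarrow> q \<in> D - {p}) \<and> (q \<in> D - {p} \<and> le p q \<longrightarrow> p \<in> D))"
    (is "?l \<longleftrightarrow> ?r")
proof
  assume ?l
  then show ?r
    using assms unfolding downclosed_def by blast
next
  assume r: ?r
  have "y \<in> D" if x: "x \<in> D" and y: "y \<in> insert p P" "le y x" for x y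
  proof (cases "x = p \<or> y = p")
    case True
    then show ?thesis
      using r x y by blast
  next
    case False
    then show ?thesis
      using r x y unfolding downclosed_def by blast
  qed
  then show ?l
    using r unfolding downclosed_def by blast
qed

lemma set_downsets: "distinct ps \<Longrightarrow> set (downsets ps) = bits ps ` {D. downclosed (set ps) leq D}"
proof (induction ps)
  case Nil
  show ?case
    by (auto simp: downclosed_def bits_def)
next
  case (Cons p ps)
  then have p: "p \<notin> set ps"
    and IH: "set (downsets ps) = bits ps ` {D. downclosed (set ps) leq D}"
    by auto
  have bits_Cons: "bits (p # ps) D = (p \<in> D) # bits ps (D - {p})" for D
    using p unfolding bits_def by auto
  have mem: "b \<in> set (downsets (p # ps)) \<longleftrightarrow>
      (\<exists>v D. b = v # bits ps D \<and> downclosed (set ps) leq D \<and> compatible p v ps (bits ps D))" for b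
  proof -
    have "b \<in> set (downsets (p # ps)) \<longleftrightarrow>
        (\<exists>v d. b = v # d \<and> d \<in> set (downsets ps) \<and> compatible p v ps d)"
    proof (cases b)
      case (Cons v d)
      then show ?thesis
        by (cases v) (simp_all add: Let_def image_iff ex_bool_eq)
    qed (simp add: Let_def image_iff)
    then show ?thesis
      unfolding IH by blast
  qed
  show ?case
  proof
    show "set (downsets (p # ps)) \<subseteq> bits (p # ps) ` {D. downclosed (set (p # ps)) leq D}"
    proof
      fix b assume "b \<in> set (downsets (p # ps))"
      then obtain v D where b: "b = v # bits ps D" and D: "downclosed (set ps) leq D"
        and comp: "compatible p v ps (bits ps D)"
        unfolding mem by blast
      define D' where "D' = (if v then insert p D else D)"
      have sub: "D \<subseteq> set ps"
        using D unfolding downclosed_def by blast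
      then have D': "D' - {p} = D" "p \<in> D' \<longleftrightarrow> v" "D' \<subseteq> insert p (set ps)"
        using p unfolding D'_def by auto
      have "downclosed (set (p # ps)) leq D'"
        using D comp D' unfolding list.set downclosed_insert[OF p] bits_def compatible_map by simp
      moreover have "b = bits (p # ps) D'"
        using b D' bits_Cons by simp
      ultimately show "b \<in> bits (p # ps) ` {D. downclosed (set (p # ps)) leq D}"
        by simp
    qed
    show "bits (p # ps) ` {D. downclosed (set (p # ps)) leq D} \<subseteq> set (downsets (p # ps))"
    proof (rule image_subsetI)
      fix D assume "D \<in> {D. downclosed (set (p # ps)) leq D}"
      then have "downclosed (insert p (set ps)) leq D"
        by simp
      then have "downclosed (set ps) leq (D - {p}) \<and>
          compatible p (p \<in> D) ps (bits ps (D - {p}))"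
        unfolding downclosed_insert[OF p] bits_def compatible_map by (elim conjE) (intro conjI)
      then show "bits (p # ps) D \<in> set (downsets (p # ps))"
        unfolding mem bits_Cons by blast
    qed
  qed
qed

lemma distinct_downsets: "distinct (downsets ps)"
  by (induction ps) (auto simp: Let_def distinct_map)

lemma length_downsets: "d \<in> set (downsets ps) \<Longrightarrow> length d = length ps"
  by (induction ps arbitrary: d) (auto simp: Let_def)

lemma set_cut_list:
  assumes "distinct ps"
  shows "set (cut_list ps) = encode ps ` cuts (set ps) leq"
proof -
  have filter: "leq (map (some_not_leq ps (bits ps D)) ps) (bits ps E) \<longleftrightarrow>
      (\<forall>x\<in>D. \<forall>y\<in>set ps - E. leq x y)" if "D \<subseteq> set ps" for D E
    using that unfolding bits_def leq_map some_not_leq_map by blast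
  have "set (cut_list ps) = {d @ e | d e. d \<in> set (downsets ps) \<and> e \<in> set (downsets ps) \<and>
      leq (map (some_not_leq ps d) ps) e}"
    unfolding cut_list_def cuts_from_def by (auto simp: Let_def)
  also have "\<dots> = encode ps ` cuts (set ps) leq"
    unfolding set_downsets[OF assms] cuts_def encode_def
    using filter by (auto simp: downclosed_def image_iff) blast+
  finally show ?thesis .
qed

lemma distinct_cut_list: "distinct (cut_list ps)"
proof -
  \<comment> \<open>All first parts have the same length \<open>n\<close>, so a concatenation
    determines its first part, and the lists coming from different \<open>d\<close> are
    disjoint.\<close>
  have "distinct (concat (map (\<lambda>d. map (append d) (filter (Q d) es)) ds))"
    if "distinct ds" "distinct es" "\<And>d. d \<in> set ds \<Longrightarrow> length d = n"
    for Q and ds es :: "bool list list" and n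
    using that by (induction ds) (auto simp: distinct_map inj_on_def)
  from this[OF distinct_downsets distinct_downsets length_downsets] show ?thesis
    unfolding cut_list_def cuts_from_def Let_def select_eq_filter .
qed

lemma length_cut_list: "x \<in> set (cut_list ps) \<Longrightarrow> length x = 2 * length ps"
  unfolding cut_list_def cuts_from_def by (auto simp: Let_def dest!: length_downsets)

text \<open>Day \<open>Suc n\<close> consists of the cuts of day \<open>n\<close>, renamed as bit
  lists. Distinctness is carried along so that each bit position stands for one element.\<close>

lemma represents_day_value_list:
  "distinct (value_list n) \<and> (\<exists>e. represents_day n (set (value_list n)) leq e)"
proof (induction n)
  case 0
  \<comment> \<open>Forms of height 0 have no options, so day 0 has one value, encoded by
    \<open>[]\<close>.\<close>
  have "G \<succeq> H" if "height G = 0" "height H = 0" for G H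
    using that by (intro geI) (use height_left_opt height_right_opt in fastforce)+
  moreover have "height (Game {||} {||}) = 0"
    by simp
  ultimately have "represents_day 0 {[]} leq (\<lambda>_. [])"
    unfolding represents_day_def by (auto simp del: height.simps)
  then show ?case
    by auto
next
  case (Suc n)
  then obtain e where dist: "distinct (value_list n)"
    and e: "represents_day n (set (value_list n)) leq e"
    by blast
  let ?ps = "value_list n"
  have "represents_day (Suc n) (encode ?ps ` cuts (set ?ps) leq) leq (encode ?ps \<circ> cut_of n e)"
  proof (rule represents_day_relabel[OF represents_day_cuts[OF e]])
    fix x y assume "x \<in> cuts (set ?ps) leq"
    then have "fst x \<subseteq> set ?ps" "snd x \<subseteq> set ?ps"
      unfolding cuts_def downclosed_def by (simp_all add: case_prod_unfold)
    then show "leq (encode ?ps x) (encode ?ps y) \<longleftrightarrow> cut_le x y"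
      by (rule leq_encode)
  qed
  then show ?case
    using set_cut_list[OF dist] distinct_cut_list[of ?ps] unfolding value_list.simps by metis
qed

section \<open>Evaluation at day 3\<close>

definition rank_below :: "bool list \<Rightarrow> nat \<Rightarrow> bool list \<Rightarrow> bool" where
  "rank_below p r x = (leq x p \<and> rank x = r)"

definition rank_above :: "bool list \<Rightarrow> nat \<Rightarrow> bool list \<Rightarrow> bool" where
  "rank_above p r x = (leq p x \<and> rank x = r)"

text \<open>Found by searching the values of day 3 for one with large rank levels below and above.\<close>

definition pivot :: "bool list" where
  "pivot = replicate 5 True @ [False] @ replicate 4 True @ replicate 12 False @
     replicate 19 True @ [False, True, False]"

text \<open>Fixes the length of the bit lists of day 3 at twice 22, that is 44, which is also the
  length of \<open>pivot\<close>.\<close>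

lemma length_value_list_2: "length (value_list 2) = 22"
  by code_simp

text \<open>The tops of the chains are dropped: the bound in \<open>card_cuts_le\<close> depends on
  the lengths alone.\<close>

lemma day3_chain_lengths:
  "map snd (greedy_chains leq (value_list 3) []) =
   [45, 42, 37, 35, 37, 28, 36, 29, 24, 27, 37, 33, 29, 29, 33, 27, 25, 27, 26, 22, 32,
     28, 27, 27, 29, 19, 26, 18, 17, 16, 25, 19, 16, 17, 21, 17, 13, 17, 14, 14, 14, 12,
     11, 20, 16, 14, 12, 11, 9, 12, 9, 8, 9, 12, 8, 7, 10, 7, 7, 1, 16, 15, 15, 11, 4, 13,
     9, 6, 10, 7, 5, 14, 9, 12, 8, 6, 9, 5, 3, 8, 4, 4, 5, 4, 3, 3, 4, 6, 3, 3, 1]"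
  by code_simp

text \<open>\<open>pivot\<close> has rank 29. The values of rank 21 below it form the lower
  antichain, those of rank 33 above it the upper one.\<close>

lemma day3_rank_below: "length (select (rank_below pivot 21) (value_list 3)) = 79"
  by code_simp

lemma day3_rank_above: "length (select (rank_above pivot 33) (value_list 3)) = 20"
  by code_simp

theorem theorem2:
  shows "(10::real) powr 28.2 < real (card (canonical_games 4)) \<and>
         real (card (canonical_games 4)) < 4.0 * 10 ^ 184"
proof
  define ps where "ps = value_list 3"
  define ks where "ks = map snd (greedy_chains leq ps [])"
  define A where "A = select (rank_below pivot 21) ps"
  define B where "B = select (rank_above pivot 33) ps"
  note counts = day3_chain_lengths[folded ps_def, folded ks_def]
    day3_rank_below[folded ps_def, folded A_def] day3_rank_above[folded ps_def, folded B_def]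
  obtain e where e: "represents_day 3 (set ps) leq e" and "distinct ps"
    using represents_day_value_list unfolding ps_def by blast
  \<comment> \<open>Day 4 is never listed: its size is the number of cuts of the listed day
    3.\<close>
  have card: "card (canonical_games 4) = card (cuts (set ps) leq)"
    using card_canonical_games[OF represents_day_cuts[OF e]] by simp
  have len: "length x = 44" if "x \<in> set ps" for x
    using that length_cut_list[of x "value_list 2"] length_value_list_2
    unfolding ps_def by (simp add: eval_nat_numeral)
  have len_pivot: "length pivot = 44"
    by (simp add: pivot_def)

  have "2 ^ (card (set A) + card (set B)) \<le> card (cuts (set ps) leq)"
  proof (rule card_cuts_ge)
    show "finite (set ps)"
      by simp
    \<comment> \<open>\<open>pivot\<close> lies between the two antichains; the common length 44
      makes transitivity through it available.\<close>
    show "leq a b" if "a \<in> set A" "b \<in> set B" for a b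
      using that leq_trans[of a pivot b] len len_pivot
      unfolding A_def B_def rank_below_def rank_above_def
      by auto
    show "x = y" if "x \<in> set A" "y \<in> set A" "leq x y" for x y
      using that leq_rank[of x y] len unfolding A_def rank_below_def by auto
    show "x = y" if "x \<in> set B" "y \<in> set B" "leq x y" for x y
      using that leq_rank[of x y] len unfolding B_def rank_above_def by auto
    show "set A \<subseteq> set ps" "set B \<subseteq> set ps"
      unfolding A_def B_def by auto
    show "leq x x" if "x \<in> set ps" for x
      by (rule represents_day_refl[OF e that])
    show "leq x z" if "x \<in> set ps" "y \<in> set ps" "z \<in> set ps" "leq x y" "leq y z" for x y z
      by (rule represents_day_trans[OF e that])
  qed
  moreover have "card (set A) = 79" "card (set B) = 20"
    using counts \<open>distinct ps\<close> distinct_card[of A] distinct_card[of B]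
    by (simp_all add: A_def B_def)
  ultimately have "2 ^ 99 \<le> card (canonical_games 4)"
    using card by simp
  then have "(2::real) ^ 99 \<le> real (card (canonical_games 4))"
    by (metis of_nat_le_iff of_nat_numeral of_nat_power)
  moreover have "(10::real) powr 28.2 \<le> 10 powr 29"
    by (rule powr_mono) simp_all
  \<comment> \<open>Rounding the exponent up to 29 reduces the claim to the integer comparison
    \<open>10 ^ 29 < 2 ^ 99\<close>.\<close>
  moreover have "(10::real) powr 29 = 10 ^ 29"
    using powr_realpow[of 10 29] by simp
  ultimately show "(10::real) powr 28.2 < real (card (canonical_games 4))"
    by simp

  have "\<exists>Cs. list_all2 (chain_below leq) Cs (greedy_chains leq ps []) \<and> \<Union>(set Cs) = set ps"
    using greedy_chains_cover[of leq "[]" "[]" "set ps" ps, OF _ _ _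
        represents_day_refl[OF e] represents_day_trans[OF e]] by simp
  then obtain Cs where Cs: "list_all2 (chain_below leq) Cs (greedy_chains leq ps [])"
    "\<Union>(set Cs) = set ps"
    by blast
  have chains: "list_all2 (\<lambda>C k. (\<forall>x\<in>C. \<forall>y\<in>C. leq x y \<or> leq y x) \<and> card C \<le> k) Cs ks"
    using Cs(1) unfolding ks_def by (auto simp: list_all2_conv_all_nth chain_below_def)
  have "real (card (cuts (set ps) leq))
      \<le> real (sum_list ks) * (\<Prod>k\<leftarrow>ks. (real k + 3)\<^sup>2 / 4)"
  proof (rule card_cuts_le[OF represents_day_finite[OF e] _ _ Cs(2)[symmetric] chains])
    show "x = y" if "x \<in> set ps" "y \<in> set ps" "leq x y" "leq y x" for x y
      by (rule represents_day_antisym[OF e that])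
    show "\<exists>m\<in>set ps. (\<forall>d\<in>D. leq d m) \<and> (\<forall>u\<in>U. leq m u)"
      if "D \<subseteq> set ps" "U \<subseteq> set ps" "\<And>d u. d \<in> D \<Longrightarrow> u \<in> U \<Longrightarrow> leq d u" for D U
      by (rule represents_day_interpolate[OF e that])
  qed
  \<comment> \<open>With the computed chain lengths inserted, this is an inequality between
    numerals.\<close>
  also have "\<dots> < 4.0 * 10 ^ 184"
    using counts by simp
  finally show "real (card (canonical_games 4)) < 4.0 * 10 ^ 184"
    using card by simp
qed

end
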